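(* Let $\mathcal{A}$ be an adequate family of subsets of $\mathbb{N}$ that contains an infinite set. Then there exists $x^*\in h_{\mathcal{A},1}^*$ such that $x^*$ is an extreme point of $B_{h_{\mathcal{A},1}^*}$ and a delta-point of $h_{\mathcal{A},1}^*$.
   Context: All Banach spaces are real. $B_X$, $S_X$, $X^*$ denote the closed unit ball, unit sphere and topological dual of a Banach space $X$. Adequate family: a family $\mathcal{A}$ of subsets of $\mathbb{N}=\{1,2,\dots\}$ is adequate if (1) it contains the empty set and all singletons $\{i\}$, $i\in\mathbb{N}$; (2) it is hereditary: $A\in\mathcal{A}$ and $B\subseteq A$ imply $B\in\mathcal{A}$; (3) it is compact for pointwise convergence, i.e. given $A\subset\mathbb{N}$, if every finite subset of $A$ is in $\mathcal{A}$, then $A\in\mathcal{A}$. The space $h_{\mathcal{A},1}$: the completion of the space $c_{00}$ of finitely supported sequences, with standard basis $(e_i)_{i\in\mathbb{N}}$, in the norm $\left\|\sum_{i=1}^n a_i e_i\right\| = \sup_{A\in\mathcal{A}}\sum_{i\in A}|a_i|$ (with $a_i=0$ for $i>n$). Slices: for $f\in S_{X^*}$ and $\delta>0$, $S(f,\delta)=\{x\in B_X : f(x)>1-\delta\}$. Delta-point: $x\in S_X$ is a delta-point of $X$ if for every slice $S(f,\delta)$ of $B_X$ with $x\in S(f,\delta)$ and every $\varepsilon>0$ there exists $y\in S(f,\delta)$ with $\|x-y\|\ge 2-\varepsilon$. (Here this is applied with $X=h_{\mathcal{A},1}^*$, so the slices are given by functionals in $S_{h_{\mathcal{A},1}^{**}}$.)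 *)

theory Defs
  imports "HOL-Analysis.Analysis"
begin

text \<open>The index set is the set of positive integers, written \<open>{1..}\<close> as a set of natural numbers.\<close>

definition adequate :: "nat set set \<Rightarrow> bool" where
  "adequate \<A> \<longleftrightarrow>
     (\<forall>A\<in>\<A>. A \<subseteq> {1..}) \<and>
     {} \<in> \<A> \<and> (\<forall>i\<ge>1. {i} \<in> \<A>) \<and>
     (\<forall>A\<in>\<A>. \<forall>B\<subseteq>A. B \<in> \<A>) \<and>
     (\<forall>A\<subseteq>{1..}. (\<forall>F\<subseteq>A. finite F \<longrightarrow> F \<in> \<A>) \<longrightarrow> A \<in> \<A>)"

text \<open>
  Types cannot depend on the family \<open>\<A>\<close>, so the completion \<open>h\<^sub>\<A>\<^sub>,\<^sub>1\<close> is presented by what a completion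
  is: a Banach space \<open>'a\<close> (the completeness is in the type class) with a linear isometric embedding
  of \<open>(c\<^sub>0\<^sub>0, \<parallel>\<cdot>\<parallel>)\<close> onto a dense subspace. The embedding is given by the images \<open>e i\<close>
  of the standard basis vectors. This determines \<open>'a\<close> and \<open>e\<close> up to isometric isomorphism.
\<close>

definition is_h1 :: "nat set set \<Rightarrow> (nat \<Rightarrow> 'a::banach) \<Rightarrow> bool" where
  "is_h1 \<A> e \<longleftrightarrow>
     (\<forall>(n::nat) (a::nat \<Rightarrow> real).
        norm (\<Sum>i=1..n. a i *\<^sub>R e i) = (SUP A\<in>\<A>. \<Sum>i\<in>A \<inter> {1..n}. \<bar>a i\<bar>)) \<and>
     closure (span (e ` {1..})) = UNIV"

text \<open>
  The norm formula is realisable for every adequate family, inside the bounded sequences; the closed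
  span of the vectors \<open>e i\<close> is then a Banach space as required in \<open>is_h1\<close>. The coordinate coded by
  a pair of finite sets \<open>F\<close>, \<open>S\<close> is \<open>\<Sum>i\<in>F. \<plusminus> a i\<close>, with sign plus for \<open>i \<in> S\<close>, if \<open>F \<in> \<A>\<close>.
\<close>

lemma h1_norm_realisable:
  assumes "adequate \<A>"
  shows "\<exists>e :: nat \<Rightarrow> (nat \<Rightarrow>\<^sub>C real). \<forall>(n::nat) (a::nat \<Rightarrow> real).
           norm (\<Sum>i=1..n. a i *\<^sub>R e i) = (SUP A\<in>\<A>. \<Sum>i\<in>A \<inter> {1..n}. \<bar>a i\<bar>)"
proof -
  define c :: "nat \<Rightarrow> nat \<Rightarrow> real" where
    "c i k = (let F = set_decode (fst (prod_decode k)); S = set_decode (snd (prod_decode k))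
              in if F \<in> \<A> \<and> i \<in> F then (if i \<in> S then 1 else - 1) else 0)" for i k
  define e where "e i = Bcontfun (c i)" for i
  have c_le: "\<bar>c i k\<bar> \<le> 1" for i k
    by (auto simp: c_def Let_def)
  have "c i \<in> bcontfun" for i
  proof -
    have "bounded (range (c i))"
      unfolding bounded_iff using c_le[of i] by (intro exI[of _ 1]) simp
    then show ?thesis by (simp add: bcontfun_def)
  qed
  then have e_app: "apply_bcontfun (e i) = c i" for i
    by (simp add: e_def Bcontfun_inverse)
  have "norm (\<Sum>i=1..n. a i *\<^sub>R e i) = (SUP A\<in>\<A>. \<Sum>i\<in>A \<inter> {1..n}. \<bar>a i\<bar>)" (is "norm ?x = ?r")
    for n :: nat and a :: "nat \<Rightarrow> real"
  proof (rule antisym)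
    have ne: "\<A> \<noteq> {}" "{} \<in> \<A>" and her: "\<And>A B. A \<in> \<A> \<Longrightarrow> B \<subseteq> A \<Longrightarrow> B \<in> \<A>"
      using assms unfolding adequate_def by blast+
    have bdd: "bdd_above ((\<lambda>A. \<Sum>i\<in>A \<inter> {1..n}. \<bar>a i\<bar>) ` \<A>)"
      by (rule bdd_aboveI[of _ "\<Sum>i=1..n. \<bar>a i\<bar>"]) (auto intro!: sum_mono2)
    have app: "apply_bcontfun ?x k = (\<Sum>i=1..n. a i * c i k)" for k
    proof -
      have "apply_bcontfun (\<Sum>i\<in>I. a i *\<^sub>R e i) k = (\<Sum>i\<in>I. a i * c i k)" if "finite I" for I
        using that by induction (auto simp: e_app)
      then show ?thesis by simp
    qed
    show "norm ?x \<le> ?r"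
    proof (rule norm_bound)
      fix k
      define F where "F = set_decode (fst (prod_decode k))"
      have "\<bar>\<Sum>i=1..n. a i * c i k\<bar> \<le> ?r"
      proof (cases "F \<in> \<A>")
        case True
        have "(\<Sum>i=1..n. a i * c i k) = (\<Sum>i\<in>F \<inter> {1..n}. a i * c i k)"
          by (rule sum.mono_neutral_right) (auto simp: c_def F_def Let_def)
        also have "\<bar>\<dots>\<bar> \<le> (\<Sum>i\<in>F \<inter> {1..n}. \<bar>a i\<bar>)"
          by (rule order.trans[OF sum_abs], rule sum_mono) (simp add: abs_mult mult_left_le c_le)
        also have "\<dots> \<le> ?r"
          by (rule cSUP_upper[OF True bdd])
        finally show ?thesis .
      next
        case False
        then have "c i k = 0" for i by (simp add: c_def F_def Let_def)
        then show ?thesis using cSUP_upper[OF ne(2) bdd] by simp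
      qed
      then show "norm (apply_bcontfun ?x k) \<le> ?r" unfolding app real_norm_def .
    qed
    show "?r \<le> norm ?x"
    proof (rule cSUP_least[OF ne(1)])
      fix A assume A: "A \<in> \<A>"
      define F where "F = A \<inter> {1..n}"
      define k where "k = prod_encode (set_encode F, set_encode {i\<in>F. a i \<ge> 0})"
      have F: "finite F" "F \<in> \<A>" using A her by (auto simp: F_def)
      have ck: "c i k = (if i \<in> F then (if a i \<ge> 0 then 1 else - 1) else 0)" for i
        using F by (simp add: c_def k_def Let_def)
      have "(\<Sum>i\<in>F. \<bar>a i\<bar>) = (\<Sum>i=1..n. a i * c i k)"
        by (rule sum.mono_neutral_cong_left) (auto simp: ck F_def)
      also have "\<dots> \<le> norm ?x"
        using norm_bounded[of ?x k] unfolding app real_norm_def by linarith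
      finally show "(\<Sum>i\<in>A \<inter> {1..n}. \<bar>a i\<bar>) \<le> norm ?x" by (simp add: F_def)
    qed
  qed
  then show ?thesis by blast
qed

definition slice :: "('x::real_normed_vector \<Rightarrow>\<^sub>L real) \<Rightarrow> real \<Rightarrow> 'x set" where
  "slice f \<delta> = {x \<in> cball 0 1. blinfun_apply f x > 1 - \<delta>}"

definition delta_point :: "'x::real_normed_vector \<Rightarrow> bool" where
  "delta_point x \<longleftrightarrow>
     x \<in> sphere 0 1 \<and>
     (\<forall>f\<in>sphere 0 1. \<forall>\<delta>>0. x \<in> slice f \<delta> \<longrightarrow>
        (\<forall>\<epsilon>>0. \<exists>y\<in>slice f \<delta>. norm (x - y) \<ge> 2 - \<epsilon>))"

end

theory Submission
  imports Defs
begin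

text \<open>
  Extend the infinite member of \<open>\<A>\<close> to a maximal member \<open>A\<close>, and let \<open>x\<^sup>*\<close> be the sum of the
  coordinate functionals over \<open>A\<close>. If \<open>x\<^sup>*\<close> lies strictly between \<open>f\<close> and \<open>g\<close> in the ball, then
  \<open>f\<close> and \<open>g\<close> are \<open>1\<close> at \<open>e i\<close> for \<open>i \<in> A\<close>; for \<open>j \<notin> A\<close> maximality gives a finite \<open>G \<subseteq> A\<close>
  with \<open>insert j G \<notin> \<A>\<close>, so that \<open>(\<Sum>i\<in>G. e i) \<plusminus> e j\<close> has norm at most \<open>card G\<close>, whence \<open>f\<close> and \<open>g\<close>
  vanish at \<open>e j\<close>. For the delta-point property, flip the sign of one coordinate \<open>k \<in> A\<close> of
  \<open>x\<^sup>*\<close>: this moves \<open>x\<^sup>*\<close> by a vector of norm \<open>2\<close>, and a functional on the dual is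
  arbitrarily small at some coordinate functional with index in \<open>A\<close>, because the sums of
  coordinate functionals over finite subsets of \<open>A\<close> lie in the ball.
\<close>

section \<open>Bounded operators determined on a dense subspace\<close>

text \<open>Linearity and the bound make \<open>g\<close> Lipschitz on \<open>S\<close>, so it has a
  uniformly continuous extension to the closure; additivity, homogeneity and the bound then pass to
  limits of sequences from \<open>S\<close>.\<close>

lemma blinfun_extend_dense:
  fixes g :: "'a::real_normed_vector \<Rightarrow> 'b::banach"
  assumes S: "subspace S" "closure S = UNIV"
    and add: "\<And>x y. x \<in> S \<Longrightarrow> y \<in> S \<Longrightarrow> g (x + y) = g x + g y"
    and scale: "\<And>c x. x \<in> S \<Longrightarrow> g (c *\<^sub>R x) = c *\<^sub>R g x"
    and K: "0 \<le> K" "\<And>x. x \<in> S \<Longrightarrow> norm (g x) \<le> K * norm x"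
  obtains \<phi> :: "'a \<Rightarrow>\<^sub>L 'b" where "norm \<phi> \<le> K" "\<And>x. x \<in> S \<Longrightarrow> blinfun_apply \<phi> x = g x"
proof -
  have diff: "g x - g y = g (x - y)" if "x \<in> S" "y \<in> S" for x y
    using add[of "x - y" y] that subspace_diff[OF S(1)] by simp
  have "K-lipschitz_on S g"
    by (rule lipschitz_onI) (auto simp: dist_norm diff K subspace_diff[OF S(1)])
  then have "uniformly_continuous_on S g"
    by (rule lipschitz_on_uniformly_continuous)
  then obtain h where h: "uniformly_continuous_on (closure S) h" "\<And>x. x \<in> S \<Longrightarrow> g x = h x"
    by (rule uniformly_continuous_on_extension_on_closure) blast
  have cont: "continuous_on UNIV h"
    using h(1) S(2) uniformly_continuous_imp_continuous by metis
  have lim: "(\<lambda>n. h (X n)) \<longlonglongrightarrow> h x" if "X \<longlonglongrightarrow> x" for X x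
    using continuous_on_tendsto_compose[OF cont that] by simp
  have ex: "\<exists>X. (\<forall>n. X n \<in> S) \<and> X \<longlonglongrightarrow> x" for x
    using S(2) closure_sequential[of x S] by simp
  have h_add: "h (x + y) = h x + h y" for x y
  proof -
    obtain X Y where X: "\<And>n. X n \<in> S" "X \<longlonglongrightarrow> x" and Y: "\<And>n. Y n \<in> S" "Y \<longlonglongrightarrow> y"
      using ex by metis
    have "(\<lambda>n. h (X n + Y n)) \<longlonglongrightarrow> h (x + y)"
      by (intro lim tendsto_add X Y)
    moreover have "(\<lambda>n. h (X n + Y n)) = (\<lambda>n. h (X n) + h (Y n))"
      using add[OF X(1) Y(1)] h(2)[OF X(1)] h(2)[OF Y(1)] h(2)[OF subspace_add[OF S(1) X(1) Y(1)]]
      by simp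
    ultimately show ?thesis
      using LIMSEQ_unique[OF _ tendsto_add[OF lim[OF X(2)] lim[OF Y(2)]]] by simp
  qed
  have h_scale: "h (c *\<^sub>R x) = c *\<^sub>R h x" for c x
  proof -
    obtain X where X: "\<And>n. X n \<in> S" "X \<longlonglongrightarrow> x"
      using ex by metis
    have "(\<lambda>n. h (c *\<^sub>R X n)) \<longlonglongrightarrow> h (c *\<^sub>R x)"
      by (intro lim tendsto_intros X)
    moreover have "(\<lambda>n. h (c *\<^sub>R X n)) = (\<lambda>n. c *\<^sub>R h (X n))"
      using scale[OF X(1)] h(2)[OF X(1)] h(2)[OF subspace_scale[OF S(1) X(1)]] by simp
    ultimately show ?thesis
      using LIMSEQ_unique[OF _ tendsto_scaleR[OF tendsto_const lim[OF X(2)]]] by simp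
  qed
  have h_bound: "norm (h x) \<le> K * norm x" for x
  proof -
    obtain X where X: "\<And>n. X n \<in> S" "X \<longlonglongrightarrow> x"
      using ex by metis
    show ?thesis
    proof (rule LIMSEQ_le)
      show "(\<lambda>n. norm (h (X n))) \<longlonglongrightarrow> norm (h x)" "(\<lambda>n. K * norm (X n)) \<longlonglongrightarrow> K * norm x"
        by (intro tendsto_intros lim X)+
      show "\<exists>N. \<forall>n\<ge>N. norm (h (X n)) \<le> K * norm (X n)"
        using K(2)[OF X(1)] h(2)[OF X(1)] by simp
    qed
  qed
  have "bounded_linear h"
    by (rule bounded_linear_intro[of _ K]) (auto simp: h_add h_scale h_bound mult.commute)
  then have app: "blinfun_apply (Blinfun h) = h"
    by (rule bounded_linear_Blinfun_apply)
  show thesis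
  proof
    show "norm (Blinfun h) \<le> K"
      by (rule norm_blinfun_bound) (auto simp: app h_bound K)
    show "blinfun_apply (Blinfun h) x = g x" if "x \<in> S" for x
      using h(2)[OF that] by (simp add: app)
  qed
qed

lemma blinfun_eq_on_dense_span:
  fixes f g :: "'a::real_normed_vector \<Rightarrow>\<^sub>L 'b::real_normed_vector"
  assumes "closure (span B) = UNIV" "\<And>b. b \<in> B \<Longrightarrow> blinfun_apply f b = blinfun_apply g b"
  shows "f = g"
proof (rule blinfun_eqI)
  fix x
  have "blinfun_apply f y = blinfun_apply g y" if "y \<in> span B" for y
    using that
    by (induction rule: span_induct_alt)
      (simp_all add: assms(2) blinfun.add_right blinfun.scaleR_right)
  then have "span B \<subseteq> {y. blinfun_apply f y = blinfun_apply g y}" by blast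
  moreover have "closed {y. blinfun_apply f y = blinfun_apply g y}"
    by (intro closed_Collect_eq continuous_intros)
  ultimately have "closure (span B) \<subseteq> {y. blinfun_apply f y = blinfun_apply g y}"
    by (rule closure_minimal)
  then show "blinfun_apply f x = blinfun_apply g x"
    using assms(1) by auto
qed

section \<open>Maximal members of adequate families\<close>

lemma adequate_subset: "adequate \<A> \<Longrightarrow> A \<in> \<A> \<Longrightarrow> A \<subseteq> {1..}"
  unfolding adequate_def by (elim conjE) (erule (1) bspec)

lemma adequate_hereditary: "adequate \<A> \<Longrightarrow> A \<in> \<A> \<Longrightarrow> B \<subseteq> A \<Longrightarrow> B \<in> \<A>"
  unfolding adequate_def by (elim conjE) metis

lemma adequate_compact:
  "adequate \<A> \<Longrightarrow> A \<subseteq> {1..} \<Longrightarrow> (\<And>F. F \<subseteq> A \<Longrightarrow> finite F \<Longrightarrow> F \<in> \<A>) \<Longrightarrow> A \<in> \<A>"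
  unfolding adequate_def by (elim conjE) metis

text \<open>Zorn's lemma applies because a finite subset of the union of a chain lies in a single
  member of the chain, so compactness puts the union into \<A>. Maximality is recorded through
  finite witnesses \<open>G\<close>, again by compactness, because the norm estimates work with
  finite sums.\<close>

lemma adequate_maximal:
  assumes "adequate \<A>" "B \<in> \<A>"
  obtains A where "A \<in> \<A>" "B \<subseteq> A"
    "\<And>j. 1 \<le> j \<Longrightarrow> j \<notin> A \<Longrightarrow> \<exists>G\<subseteq>A. finite G \<and> insert j G \<notin> \<A>"
proof -
  note sub = adequate_subset[OF assms(1)]
  note her = adequate_hereditary[OF assms(1)]
  note cpt = adequate_compact[OF assms(1)]
  have "\<exists>M\<in>{A\<in>\<A>. B \<subseteq> A}. \<forall>X\<in>{A\<in>\<A>. B \<subseteq> A}. M \<subseteq> X \<longrightarrow> X = M"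
  proof (rule subset_Zorn_nonempty)
    show "{A\<in>\<A>. B \<subseteq> A} \<noteq> {}"
      using assms(2) by blast
    fix C assume C: "C \<noteq> {}" "subset.chain {A\<in>\<A>. B \<subseteq> A} C"
    then have C': "C \<subseteq> {A\<in>\<A>. B \<subseteq> A}"
      by (simp add: subset.chain_def)
    have "\<Union>C \<in> \<A>"
    proof (rule cpt)
      show "\<Union>C \<subseteq> {1..}"
        using C' sub by (intro Union_least) auto
      fix F assume "F \<subseteq> \<Union>C" "finite F"
      then obtain A where "A \<in> C" "F \<subseteq> A"
        using finite_subset_Union_chain[OF _ _ C] by blast
      then show "F \<in> \<A>"
        using C' her by blast
    qed
    then show "\<Union>C \<in> {A\<in>\<A>. B \<subseteq> A}"
      using C(1) C' by blast
  qed
  then obtain M where M: "M \<in> \<A>" "B \<subseteq> M" "\<And>X. X \<in> \<A> \<Longrightarrow> M \<subseteq> X \<Longrightarrow> X = M"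
    by (smt (verit) mem_Collect_eq order_trans)
  show thesis
  proof (rule that[OF M(1,2)])
    fix j :: nat assume j: "1 \<le> j" "j \<notin> M"
    have "insert j M \<notin> \<A>"
      using M(3) j(2) by blast
    moreover have "insert j M \<subseteq> {1..}"
      using sub[OF M(1)] j(1) by simp
    ultimately obtain F where F: "F \<subseteq> insert j M" "finite F" "F \<notin> \<A>"
      using cpt[of "insert j M"] by metis
    \<comment> \<open>By heredity: \<open>F\<close> is contained in
      \<open>insert j (F - {j})\<close>, whether or not it contains \<open>j\<close>.\<close>
    then have "insert j (F - {j}) \<notin> \<A>"
      using her[of "insert j (F - {j})" F] by blast
    then show "\<exists>G\<subseteq>M. finite G \<and> insert j G \<notin> \<A>"
      using F by (intro exI[of _ "F - {j}"]) auto
  qed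
qed

section \<open>Functionals with prescribed values on the basis\<close>

text \<open>The vanishing of the coefficients beyond \<open>n\<close> allows representations of
  different lengths to be padded to a common range.\<close>

lemma span_image_atLeast_one:
  fixes e :: "nat \<Rightarrow> 'a::real_vector"
  assumes "x \<in> span (e ` {1..})"
  obtains n a where "x = (\<Sum>i=1..n. a i *\<^sub>R e i)" "\<And>i. n < i \<Longrightarrow> a i = 0"
proof -
  have "\<exists>n a. x = (\<Sum>i=1..n. a i *\<^sub>R e i) \<and> (\<forall>i>n. a i = 0)"
    using assms
  proof (induction rule: span_induct_alt)
    case base
    show ?case by (intro exI[of _ 0] exI[of _ "\<lambda>_. 0"]) simp
  next
    case (step c b y)
    then obtain k n a where k: "1 \<le> k" "b = e k" and
      y: "y = (\<Sum>i=1..n. a i *\<^sub>R e i)" "\<And>i. i > n \<Longrightarrow> a i = 0"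
      by auto
    define a' where "a' i = (if i = k then c else 0) + a i" for i
    have "y = (\<Sum>i=1..max n k. a i *\<^sub>R e i)"
      unfolding y(1) by (rule sum.mono_neutral_left) (auto simp: y(2))
    moreover have "c *\<^sub>R e k = (\<Sum>i=1..max n k. (if i = k then c else 0) *\<^sub>R e i)"
      using k(1) by (simp add: if_distrib[of "\<lambda>t. t *\<^sub>R _"] cong: if_cong)
    ultimately have "c *\<^sub>R b + y = (\<Sum>i=1..max n k. a' i *\<^sub>R e i)"
      by (simp add: a'_def k(2) scaleR_add_left sum.distrib)
    moreover have "\<forall>i>max n k. a' i = 0"
      by (auto simp: a'_def y(2))
    ultimately show ?case by blast
  qed
  then show thesis using that by blast
qed

text \<open>The bound serves twice: coefficients that represent 0 are sent to 0, which makes the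
  functional well defined on the span, and the extension to the whole space has norm at most
  1.\<close>

lemma h1_coefficient_functional:
  fixes e :: "nat \<Rightarrow> 'a::real_normed_vector" and \<theta> :: "nat \<Rightarrow> real"
  assumes dense: "closure (span (e ` {1..})) = UNIV"
    and bound: "\<And>n a. \<bar>\<Sum>i=1..n. a i * \<theta> i\<bar> \<le> norm (\<Sum>i=1..n. a i *\<^sub>R e i)"
  obtains \<phi> :: "'a \<Rightarrow>\<^sub>L real" where "norm \<phi> \<le> 1" "\<And>i. 1 \<le> i \<Longrightarrow> blinfun_apply \<phi> (e i) = \<theta> i"
proof -
  let ?S = "span (e ` {1..})"
  have "\<forall>x\<in>?S. \<exists>n a. x = (\<Sum>i=1..n. a i *\<^sub>R e i) \<and> (\<forall>i>n. a i = 0)"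
    by (metis span_image_atLeast_one)
  then obtain N c where Nc: "\<And>x. x \<in> ?S \<Longrightarrow> x = (\<Sum>i=1..N x. c x i *\<^sub>R e i)"
    "\<And>x i. x \<in> ?S \<Longrightarrow> i > N x \<Longrightarrow> c x i = 0"
    by metis
  define g where "g x = (\<Sum>i=1..N x. c x i * \<theta> i)" for x
  have pad: "x = (\<Sum>i=1..n. c x i *\<^sub>R e i)" "g x = (\<Sum>i=1..n. c x i * \<theta> i)"
    if "x \<in> ?S" "N x \<le> n" for x n
  proof -
    have "(\<Sum>i=1..N x. c x i *\<^sub>R e i) = (\<Sum>i=1..n. c x i *\<^sub>R e i)"
      using that Nc(2) by (intro sum.mono_neutral_left) auto
    then show "x = (\<Sum>i=1..n. c x i *\<^sub>R e i)"
      using Nc(1)[OF that(1)] by simp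
    show "g x = (\<Sum>i=1..n. c x i * \<theta> i)"
      unfolding g_def using that Nc(2) by (intro sum.mono_neutral_left) auto
  qed
  have g_eq: "g x = (\<Sum>i=1..n. a i * \<theta> i)" if x: "x \<in> ?S" "x = (\<Sum>i=1..n. a i *\<^sub>R e i)" for x n a
  proof -
    define m where "m = max n (N x)"
    \<comment> \<open>The values of \<open>a\<close> beyond \<open>n\<close> are arbitrary, so they
      are cut off before the range grows to \<open>m\<close>.\<close>
    define b where "b i = (if i \<le> n then a i else 0)" for i
    have "x = (\<Sum>i=1..m. b i *\<^sub>R e i)"
      unfolding x(2) by (rule sum.mono_neutral_cong_left) (auto simp: b_def m_def)
    moreover have "x = (\<Sum>i=1..m. c x i *\<^sub>R e i)"
      by (rule pad) (use x(1) in \<open>auto simp: m_def\<close>)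
    ultimately have "(\<Sum>i=1..m. (c x i - b i) *\<^sub>R e i) = 0"
      by (simp add: scaleR_diff_left sum_subtractf)
    then have "(\<Sum>i=1..m. (c x i - b i) * \<theta> i) = 0"
      using bound[of "\<lambda>i. c x i - b i" m] by simp
    then have "(\<Sum>i=1..m. c x i * \<theta> i) = (\<Sum>i=1..m. b i * \<theta> i)"
      by (simp add: left_diff_distrib sum_subtractf)
    also have "\<dots> = (\<Sum>i=1..n. a i * \<theta> i)"
      by (rule sum.mono_neutral_cong_right) (auto simp: b_def m_def)
    finally show ?thesis
      using pad(2)[OF x(1), of m] by (simp add: m_def)
  qed
  have g_add: "g (x + y) = g x + g y" if x: "x \<in> ?S" and y: "y \<in> ?S" for x y
  proof -
    define m where "m = max (N x) (N y)"
    have "x + y = (\<Sum>i=1..m. (c x i + c y i) *\<^sub>R e i)"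
      using pad(1)[OF x, of m] pad(1)[OF y, of m]
      by (simp add: m_def scaleR_add_left sum.distrib)
    then have "g (x + y) = (\<Sum>i=1..m. (c x i + c y i) * \<theta> i)"
      using x y by (intro g_eq span_add)
    then show ?thesis
      using pad(2)[OF x, of m] pad(2)[OF y, of m] by (simp add: m_def distrib_right sum.distrib)
  qed
  have g_scale: "g (t *\<^sub>R x) = t *\<^sub>R g x" if x: "x \<in> ?S" for t x
  proof -
    have "t *\<^sub>R x = (\<Sum>i=1..N x. (t * c x i) *\<^sub>R e i)"
      by (subst Nc(1)[OF x]) (simp add: scaleR_sum_right)
    then have "g (t *\<^sub>R x) = (\<Sum>i=1..N x. (t * c x i) * \<theta> i)"
      using x by (intro g_eq span_scale)
    then show ?thesis
      by (simp add: g_def sum_distrib_left mult.assoc)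
  qed
  have g_norm: "norm (g x) \<le> 1 * norm x" if x: "x \<in> ?S" for x
    using bound[of "c x" "N x"] Nc(1)[OF x] by (simp add: g_def)
  obtain \<phi> :: "'a \<Rightarrow>\<^sub>L real" where
    \<phi>: "norm \<phi> \<le> 1" "\<And>x. x \<in> ?S \<Longrightarrow> blinfun_apply \<phi> x = g x"
    using blinfun_extend_dense[OF subspace_span dense, of g 1] g_add g_scale g_norm by auto
  show thesis
  proof (rule that[OF \<phi>(1)])
    fix i :: nat assume i: "1 \<le> i"
    have mem: "e i \<in> ?S"
      using i by (intro span_base) auto
    have "g (e i) = (\<Sum>k=1..i. (if k = i then 1 else 0) * \<theta> k)"
      by (rule g_eq[OF mem]) (use i in \<open>simp add: if_distrib[of "\<lambda>t. t *\<^sub>R _"] cong: if_cong\<close>)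
    also have "\<dots> = \<theta> i"
      using i by (simp add: if_distrib[of "\<lambda>t. t * _"] cong: if_cong)
    finally show "blinfun_apply \<phi> (e i) = \<theta> i"
      using \<phi>(2)[OF mem] by simp
  qed
qed

section \<open>Norm estimates in the space\<close>

lemma
  fixes e :: "nat \<Rightarrow> 'a::banach"
  assumes ad: "adequate \<A>" and h1: "is_h1 \<A> e"
  shows h1_norm_ge: "A \<in> \<A> \<Longrightarrow> (\<Sum>i\<in>A \<inter> {1..n}. \<bar>a i\<bar>) \<le> norm (\<Sum>i=1..n. a i *\<^sub>R e i)"
    and h1_norm_le:
      "(\<And>A. A \<in> \<A> \<Longrightarrow> (\<Sum>i\<in>A \<inter> {1..n}. \<bar>a i\<bar>) \<le> c) \<Longrightarrow> norm (\<Sum>i=1..n. a i *\<^sub>R e i) \<le> c"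
proof -
  have norm: "norm (\<Sum>i=1..n. a i *\<^sub>R e i) = (SUP A\<in>\<A>. \<Sum>i\<in>A \<inter> {1..n}. \<bar>a i\<bar>)"
    using h1 unfolding is_h1_def by blast
  have bdd: "bdd_above ((\<lambda>A. \<Sum>i\<in>A \<inter> {1..n}. \<bar>a i\<bar>) ` \<A>)"
    by (rule bdd_aboveI[of _ "\<Sum>i=1..n. \<bar>a i\<bar>"]) (auto intro!: sum_mono2)
  show "(\<Sum>i\<in>A \<inter> {1..n}. \<bar>a i\<bar>) \<le> norm (\<Sum>i=1..n. a i *\<^sub>R e i)" if "A \<in> \<A>"
    unfolding norm by (rule cSUP_upper[OF that bdd])
  have "\<A> \<noteq> {}"
    using ad unfolding adequate_def by blast
  then show "norm (\<Sum>i=1..n. a i *\<^sub>R e i) \<le> c" if "\<And>A. A \<in> \<A> \<Longrightarrow> (\<Sum>i\<in>A \<inter> {1..n}. \<bar>a i\<bar>) \<le> c"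
    unfolding norm by (rule cSUP_least) (rule that)
qed

text \<open>Only members of \<A> inside \<open>F\<close> have to be tested, since heredity lets any
  member \<open>A\<close> be replaced by \<open>A \<inter> F\<close>.\<close>

lemma h1_norm_finite_le:
  fixes e :: "nat \<Rightarrow> 'a::banach"
  assumes "adequate \<A>" "is_h1 \<A> e" "finite F" "F \<subseteq> {1..}"
    and c: "\<And>A. A \<in> \<A> \<Longrightarrow> A \<subseteq> F \<Longrightarrow> (\<Sum>i\<in>A. \<bar>a i\<bar>) \<le> c"
  shows "norm (\<Sum>i\<in>F. a i *\<^sub>R e i) \<le> c"
proof -
  define b where "b i = (if i \<in> F then a i else 0)" for i
  obtain n where n: "F \<subseteq> {..n}"
    using assms(3) finite_nat_iff_bounded_le by blast
  have "(\<Sum>i\<in>F. a i *\<^sub>R e i) = (\<Sum>i=1..n. b i *\<^sub>R e i)"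
    using n assms(4) by (intro sum.mono_neutral_cong_left) (auto simp: b_def)
  moreover have "norm (\<Sum>i=1..n. b i *\<^sub>R e i) \<le> c"
  proof (rule h1_norm_le[OF assms(1,2)])
    fix A assume A: "A \<in> \<A>"
    have "(\<Sum>i\<in>A \<inter> {1..n}. \<bar>b i\<bar>) = (\<Sum>i\<in>A \<inter> F. \<bar>a i\<bar>)"
      using n assms(4) by (intro sum.mono_neutral_cong_right) (auto simp: b_def)
    also have "\<dots> \<le> c"
      by (intro c adequate_hereditary[OF assms(1) A]) auto
    finally show "(\<Sum>i\<in>A \<inter> {1..n}. \<bar>b i\<bar>) \<le> c" .
  qed
  ultimately show ?thesis by simp
qed

text \<open>Pairing with \<theta> sees only coordinates in \<open>A\<close>, so it is bounded by the
  absolute sum over \<open>A\<close>, one of the competitors in the supremum that defines the norm.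
  This is the source of every concrete functional below: the extreme point, the coordinate
  functionals, their finite sums and the sign flips.\<close>

lemma h1_functional:
  fixes e :: "nat \<Rightarrow> 'a::banach" and \<theta> :: "nat \<Rightarrow> real"
  assumes "adequate \<A>" "is_h1 \<A> e" "A \<in> \<A>"
    and \<theta>: "\<And>i. \<bar>\<theta> i\<bar> \<le> 1" "\<And>i. i \<notin> A \<Longrightarrow> \<theta> i = 0"
  obtains \<phi> :: "'a \<Rightarrow>\<^sub>L real" where "norm \<phi> \<le> 1" "\<And>i. 1 \<le> i \<Longrightarrow> blinfun_apply \<phi> (e i) = \<theta> i"
proof (rule h1_coefficient_functional)
  show "closure (span (e ` {1..})) = UNIV"
    using assms(2) by (simp add: is_h1_def)
  show "\<bar>\<Sum>i=1..n. a i * \<theta> i\<bar> \<le> norm (\<Sum>i=1..n. a i *\<^sub>R e i)" for n and a :: "nat \<Rightarrow> real"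
  proof -
    have "(\<Sum>i=1..n. a i * \<theta> i) = (\<Sum>i\<in>A \<inter> {1..n}. a i * \<theta> i)"
      by (rule sum.mono_neutral_right) (use \<theta>(2) in auto)
    also have "\<bar>\<dots>\<bar> \<le> (\<Sum>i\<in>A \<inter> {1..n}. \<bar>a i\<bar>)"
      by (rule order.trans[OF sum_abs], rule sum_mono) (simp add: abs_mult mult_left_le \<theta>(1))
    also have "\<dots> \<le> norm (\<Sum>i=1..n. a i *\<^sub>R e i)"
      by (rule h1_norm_ge[OF assms(1-3)])
    finally show ?thesis .
  qed
qed (use that in blast)

lemma h1_norm_basis:
  fixes e :: "nat \<Rightarrow> 'a::banach"
  assumes "adequate \<A>" "is_h1 \<A> e" "1 \<le> i"
  shows "norm (e i) \<le> 1"
proof -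
  have "norm (\<Sum>k\<in>{i}. 1 *\<^sub>R e k) \<le> 1"
    by (rule h1_norm_finite_le[OF assms(1,2)]) (use assms(3) in \<open>auto simp: subset_singleton_iff\<close>)
  then show ?thesis by simp
qed

text \<open>Since \<open>f\<close> already attains \<open>card G\<close> on the sum of the
  \<open>e i\<close> over \<open>G\<close>, and adding \<open>e j\<close> with either sign keeps the
  norm at most \<open>card G\<close>, there is no room for a nonzero value at
  \<open>e j\<close>.\<close>

lemma h1_functional_vanishes:
  fixes e :: "nat \<Rightarrow> 'a::banach" and f :: "'a \<Rightarrow>\<^sub>L real"
  assumes ad: "adequate \<A>" and h1: "is_h1 \<A> e" and f: "norm f \<le> 1"
    and G: "finite G" "G \<subseteq> {1..}" "\<And>i. i \<in> G \<Longrightarrow> blinfun_apply f (e i) = 1"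
    and j: "1 \<le> j" "j \<notin> G" "insert j G \<notin> \<A>"
  shows "blinfun_apply f (e j) = 0"
proof -
  have le: "s * blinfun_apply f (e j) \<le> 0" if s: "\<bar>s\<bar> = 1" for s :: real
  proof -
    define a where "a i = (if i = j then s else 1)" for i
    let ?v = "\<Sum>i\<in>insert j G. a i *\<^sub>R e i"
    have "norm ?v \<le> card G"
    proof (rule h1_norm_finite_le[OF ad h1])
      fix A assume A: "A \<in> \<A>" "A \<subseteq> insert j G"
      \<comment> \<open>Each competitor misses at least one element of \<open>insert j G\<close>, so
        it has at most \<open>card G\<close> elements, all with coefficients of modulus 1.\<close>
      then have "A \<subset> insert j G"
        using j(3) by blast
      then have "card A < card (insert j G)"
        using G(1) by (intro psubset_card_mono) auto
      moreover have "(\<Sum>i\<in>A. \<bar>a i\<bar>) = card A"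
        using s by (simp add: a_def if_distrib cong: if_cong)
      ultimately show "(\<Sum>i\<in>A. \<bar>a i\<bar>) \<le> card G"
        using G(1) j(2) by simp
    qed (use G j in auto)
    moreover have "blinfun_apply f ?v \<le> norm ?v"
      using norm_blinfun[of f ?v] mult_right_mono[OF f norm_ge_zero[of ?v]] by simp
    moreover have "blinfun_apply f ?v = s * blinfun_apply f (e j) + card G"
    proof -
      have "(\<Sum>i\<in>G. a i * blinfun_apply f (e i)) = (\<Sum>i\<in>G. 1)"
        using j(2) G(3) by (intro sum.cong) (auto simp: a_def)
      then show ?thesis
        using G(1) j(2) by (simp add: blinfun.sum_right blinfun.add_right blinfun.scaleR_right a_def)
    qed
    ultimately show ?thesis by simp
  qed
  show ?thesis
    using le[of 1] le[of "-1"] by simp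
qed

section \<open>Extremality from maximality\<close>

text \<open>The value 1 is the largest that a functional in the ball can take at \<open>e i\<close>,
  so the endpoints of a segment through \<open>x\<close> also take it for every
  \<open>i \<in> A\<close>. Maximality of \<open>A\<close> leaves \<open>x\<close> as the only such
  functional.\<close>

lemma h1_maximal_functional_extreme:
  fixes e :: "nat \<Rightarrow> 'a::banach" and x :: "'a \<Rightarrow>\<^sub>L real"
  assumes ad: "adequate \<A>" and h1: "is_h1 \<A> e" and A: "A \<in> \<A>"
    and max: "\<And>j. 1 \<le> j \<Longrightarrow> j \<notin> A \<Longrightarrow> \<exists>G\<subseteq>A. finite G \<and> insert j G \<notin> \<A>"
    and x: "norm x \<le> 1" "\<And>i. 1 \<le> i \<Longrightarrow> blinfun_apply x (e i) = (if i \<in> A then 1 else 0)"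
  shows "x extreme_point_of cball 0 1"
proof -
  have sub: "A \<subseteq> {1..}"
    by (rule adequate_subset[OF ad]) (use A in simp)
  have dense: "closure (span (e ` {1..})) = UNIV"
    using h1 by (simp add: is_h1_def)
  have unique: "f = x" if f: "norm f \<le> 1" "\<And>i. i \<in> A \<Longrightarrow> blinfun_apply f (e i) = 1" for f
  proof (rule blinfun_eq_on_dense_span[OF dense])
    fix b assume "b \<in> e ` {1..}"
    then obtain j where j: "b = e j" "1 \<le> j" by auto
    show "blinfun_apply f b = blinfun_apply x b"
    proof (cases "j \<in> A")
      case True
      then show ?thesis using x(2)[OF j(2)] by (simp add: j(1) f(2))
    next
      case False
      then obtain G where G: "G \<subseteq> A" "finite G" "insert j G \<notin> \<A>"
        using max j(2) by blast
      have "blinfun_apply f (e j) = 0"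
        by (rule h1_functional_vanishes[OF ad h1 f(1) G(2) _ _ j(2) _ G(3)])
          (use G(1) sub False f(2) in auto)
      then show ?thesis using False x(2)[OF j(2)] by (simp add: j(1))
    qed
  qed
  show ?thesis
    unfolding extreme_point_of_def
  proof (intro conjI ballI notI)
    show "x \<in> cball 0 1"
      using x(1) by simp
    fix f g assume fg: "f \<in> cball 0 1" "g \<in> cball 0 1" and "x \<in> open_segment f g"
    then obtain u where ne: "f \<noteq> g" and u: "0 < u" "u < 1" "x = (1 - u) *\<^sub>R f + u *\<^sub>R g"
      unfolding in_segment by blast
    have nfg: "norm f \<le> 1" "norm g \<le> 1"
      using fg by auto
    have one: "blinfun_apply f (e i) = 1 \<and> blinfun_apply g (e i) = 1" if i: "i \<in> A" for i
    proof -
      have i1: "1 \<le> i" using i sub by auto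
      have le: "blinfun_apply h (e i) \<le> 1" if "norm h \<le> 1" for h :: "'a \<Rightarrow>\<^sub>L real"
        using norm_blinfun[of h "e i"] mult_mono[OF that h1_norm_basis[OF ad h1 i1]] by simp
      have "1 = blinfun_apply ((1 - u) *\<^sub>R f + u *\<^sub>R g) (e i)"
        using x(2)[OF i1] i u(3) by simp
      \<comment> \<open>A combination with positive weights of two nonnegative defects is zero, so
        both defects are zero.\<close>
      then have eq: "(1 - u) * (1 - blinfun_apply f (e i)) + u * (1 - blinfun_apply g (e i)) = 0"
        unfolding blinfun.add_left blinfun.scaleR_left by (simp add: algebra_simps)
      have "(1 - u) * (1 - blinfun_apply f (e i)) \<ge> 0" "u * (1 - blinfun_apply g (e i)) \<ge> 0"
        using u(1,2) le nfg by auto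
      then show ?thesis
        using eq u(1,2) by (simp add: add_nonneg_eq_0_iff)
    qed
    then have "f = x" "g = x"
      using unique nfg by blast+
    then show False using ne by simp
  qed
qed

section \<open>The delta-point property from infinitude\<close>

text \<open>Passing from \<open>x\<close> to \<open>x - 2 *\<^sub>R d k\<close> changes the value of
  \<open>f\<close> by \<open>- 2 * f (d k)\<close>. Infinitely many indices \<open>k\<close> are
  available, so one can be chosen for which this loss is too small to leave the slice.\<close>

lemma h1_infinite_functional_delta_point:
  fixes e :: "nat \<Rightarrow> 'a::banach" and x :: "'a \<Rightarrow>\<^sub>L real"
  assumes ad: "adequate \<A>" and h1: "is_h1 \<A> e" and A: "A \<in> \<A>" "infinite A"
    and x: "norm x \<le> 1" "\<And>i. 1 \<le> i \<Longrightarrow> blinfun_apply x (e i) = (if i \<in> A then 1 else 0)"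
  shows "delta_point x"
proof -
  have sub: "A \<subseteq> {1..}"
    by (rule adequate_subset[OF ad]) (use A in simp)
  have dense: "closure (span (e ` {1..})) = UNIV"
    using h1 by (simp add: is_h1_def)
  have norm_ge: "norm f \<ge> \<bar>blinfun_apply f (e i)\<bar>" if "1 \<le> i" for f :: "'a \<Rightarrow>\<^sub>L real" and i
    using norm_blinfun[of f "e i"] mult_left_mono[OF h1_norm_basis[OF ad h1 that] norm_ge_zero[of f]]
    by simp
  have "\<exists>\<phi> :: 'a \<Rightarrow>\<^sub>L real. \<forall>j\<ge>1. blinfun_apply \<phi> (e j) = (if j = i then 1 else 0)" if i: "i \<in> A" for i
  proof -
    obtain \<phi> :: "'a \<Rightarrow>\<^sub>L real" where
      "\<And>j. 1 \<le> j \<Longrightarrow> blinfun_apply \<phi> (e j) = (if j = i then 1 else 0)"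
      by (rule h1_functional[OF ad h1 A(1), of "\<lambda>j. if j = i then 1 else 0"]) (use i in auto)
    then show ?thesis by blast
  qed
  then obtain d :: "nat \<Rightarrow> 'a \<Rightarrow>\<^sub>L real" where
    d: "\<And>i j. i \<in> A \<Longrightarrow> 1 \<le> j \<Longrightarrow> blinfun_apply (d i) (e j) = (if j = i then 1 else 0)"
    by metis
  have sum_d: "norm (\<Sum>i\<in>F. d i) \<le> 1" if F: "finite F" "F \<subseteq> A" for F
  proof -
    obtain \<phi> :: "'a \<Rightarrow>\<^sub>L real" where
      \<phi>: "norm \<phi> \<le> 1" "\<And>j. 1 \<le> j \<Longrightarrow> blinfun_apply \<phi> (e j) = (if j \<in> F then 1 else 0)"
      by (rule h1_functional[OF ad h1 A(1), of "\<lambda>j. if j \<in> F then 1 else 0"]) (use F in auto)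
    have "(\<Sum>i\<in>F. d i) = \<phi>"
    proof (rule blinfun_eq_on_dense_span[OF dense])
      fix b assume "b \<in> e ` {1..}"
      then obtain j where j: "b = e j" "1 \<le> j" by auto
      have "(\<Sum>i\<in>F. blinfun_apply (d i) (e j)) = (\<Sum>i\<in>F. if j = i then 1 else 0)"
        using F(2) j(2) d by (intro sum.cong) auto
      then show "blinfun_apply (\<Sum>i\<in>F. d i) b = blinfun_apply \<phi> b"
        using F(1) by (simp add: j(1) \<phi>(2)[OF j(2)] blinfun.sum_left)
    qed
    then show ?thesis using \<phi>(1) by simp
  qed
  \<comment> \<open>The flipped functional still has coefficients in [-1, 1] supported on
    \<open>A\<close>.\<close>
  have flip: "norm (x - 2 *\<^sub>R d k) \<le> 1" if k: "k \<in> A" for k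
  proof -
    obtain \<phi> :: "'a \<Rightarrow>\<^sub>L real" where
      \<phi>: "norm \<phi> \<le> 1"
        "\<And>j. 1 \<le> j \<Longrightarrow> blinfun_apply \<phi> (e j) = (if j = k then -1 else if j \<in> A then 1 else 0)"
      by (rule h1_functional[OF ad h1 A(1), of "\<lambda>j. if j = k then -1 else if j \<in> A then 1 else 0"])
        (use k in auto)
    have "x - 2 *\<^sub>R d k = \<phi>"
    proof (rule blinfun_eq_on_dense_span[OF dense])
      fix b assume "b \<in> e ` {1..}"
      then obtain j where j: "b = e j" "1 \<le> j" by auto
      show "blinfun_apply (x - 2 *\<^sub>R d k) b = blinfun_apply \<phi> b"
        using k by (simp add: j(1) \<phi>(2)[OF j(2)] x(2)[OF j(2)] d[OF k j(2)]
            blinfun.diff_left blinfun.scaleR_left)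
    qed
    then show ?thesis using \<phi>(1) by simp
  qed
  \<comment> \<open>A one-sided estimate suffices: a negative value of \<open>f (d k)\<close> only
    raises the value of \<open>f\<close> at the flipped point.\<close>
  have small: "\<exists>k\<in>A. blinfun_apply f (d k) < \<eta>" if f: "norm f \<le> 1" and \<eta>: "0 < \<eta>"
    for f :: "('a \<Rightarrow>\<^sub>L real) \<Rightarrow>\<^sub>L real" and \<eta>
  proof (rule ccontr)
    assume "\<not> ?thesis"
    then have ge: "\<eta> \<le> blinfun_apply f (d k)" if "k \<in> A" for k
      using that by force
    \<comment> \<open>With \<open>n\<close> indices all giving values at least \<eta>,
      \<open>f\<close> would exceed 1 on a sum of coordinate functionals that lies in the
      ball.\<close>
    obtain n :: nat where n: "1 < real n * \<eta>"
      using reals_Archimedean3[OF \<eta>] by blast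
    obtain F where F: "F \<subseteq> A" "card F = n" "finite F"
      using infinite_arbitrarily_large[OF A(2)] by blast
    have "real n * \<eta> \<le> (\<Sum>k\<in>F. blinfun_apply f (d k))"
      using sum_bounded_below[of F \<eta> "\<lambda>k. blinfun_apply f (d k)"] ge F by auto
    also have "\<dots> = blinfun_apply f (\<Sum>k\<in>F. d k)"
      by (simp add: blinfun.sum_right)
    also have "\<dots> \<le> 1"
      using norm_blinfun[of f "\<Sum>k\<in>F. d k"] mult_mono[OF f sum_d[OF F(3,1)]] by simp
    finally show False using n by simp
  qed
  obtain i where i: "i \<in> A"
    using A(2) by fastforce
  then have "norm x = 1"
    using norm_ge[of i x] x sub by auto
  moreover have "\<exists>y\<in>slice f \<delta>. norm (x - y) \<ge> 2 - \<epsilon>"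
    if f: "norm f = 1" and xf: "x \<in> slice f \<delta>" and \<epsilon>: "0 < \<epsilon>"
    for f :: "('a \<Rightarrow>\<^sub>L real) \<Rightarrow>\<^sub>L real" and \<delta> \<epsilon>
  proof -
    \<comment> \<open>Half of the slack of \<open>x\<close> in the slice, because the flip subtracts
      \<open>d k\<close> twice.\<close>
    have gap: "0 < (blinfun_apply f x - (1 - \<delta>)) / 2"
      using xf by (simp add: slice_def)
    obtain k where k: "k \<in> A" "blinfun_apply f (d k) < (blinfun_apply f x - (1 - \<delta>)) / 2"
      using small[OF _ gap, of f] f by auto
    have k1: "1 \<le> k"
      using k(1) sub by auto
    show ?thesis
    proof
      show "x - 2 *\<^sub>R d k \<in> slice f \<delta>"
        using flip[OF k(1)] k(2)
        by (simp add: slice_def blinfun.diff_right blinfun.scaleR_right field_simps)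
      \<comment> \<open>The difference is \<open>2 *\<^sub>R d k\<close>, and evaluation at
        \<open>e k\<close> shows that \<open>d k\<close> has norm at least 1.\<close>
      show "norm (x - (x - 2 *\<^sub>R d k)) \<ge> 2 - \<epsilon>"
        using norm_ge[OF k1, of "d k"] d[OF k(1) k1] \<epsilon> by simp
    qed
  qed
  ultimately show ?thesis
    by (simp add: delta_point_def)
qed

theorem proposition4p2:
  fixes \<A> :: "nat set set" and e :: "nat \<Rightarrow> 'a::banach"
  assumes "adequate \<A>"
    and "\<exists>A\<in>\<A>. infinite A"
    and "is_h1 \<A> e"
  shows "\<exists>x :: 'a \<Rightarrow>\<^sub>L real. x extreme_point_of cball 0 1 \<and> delta_point x"
proof -
  obtain B where B: "B \<in> \<A>" "infinite B"
    using assms(2) by blast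
  \<comment> \<open>One set serves both claims: maximality gives extremality, and containing
    \<open>B\<close> keeps \<open>A\<close> infinite for the delta-point property.\<close>
  obtain A where A: "A \<in> \<A>" "B \<subseteq> A"
    "\<And>j. 1 \<le> j \<Longrightarrow> j \<notin> A \<Longrightarrow> \<exists>G\<subseteq>A. finite G \<and> insert j G \<notin> \<A>"
    by (rule adequate_maximal[OF assms(1) B(1)], rule that) blast+
  have inf: "infinite A"
    using A(2) B(2) finite_subset by blast
  obtain x :: "'a \<Rightarrow>\<^sub>L real" where
    x: "norm x \<le> 1" "\<And>i. 1 \<le> i \<Longrightarrow> blinfun_apply x (e i) = (if i \<in> A then 1 else 0)"
    by (rule h1_functional[OF assms(1,3) A(1), of "\<lambda>i. if i \<in> A then 1 else 0"]) auto
  have "x extreme_point_of cball 0 1"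
    using assms(1,3) A(1,3) x by (rule h1_maximal_functional_extreme)
  moreover have "delta_point x"
    using assms(1,3) A(1) inf x by (rule h1_infinite_functional_delta_point)
  ultimately show ?thesis by blast
qed

end
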